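(* Consider a network with routes of length one. 1. A resource allocation $(\Lambda_i)_{i\in I}=(n_ix_i)_{i\in I}\ge 0$ is feasible if and only if the following generalized cut constraints hold: $$\sum_{i\in I(J')}\Lambda_i\le\sum_{j\in J'}C_j\qquad\text{for all } J'\in\mathscr{SC}(J).$$ 2. None of these constraints is redundant, i.e. excluding any one of them does not guarantee feasibility: for every $\tilde J\in\mathscr{SC}(J)$ there exists $(\Lambda_i)_{i\in I}\ge0$ which satisfies the constraints for all $J'\in\mathscr{SC}(J)\setminus\{\tilde J\}$ but is not feasible.
   Context: Network: $I$ is a finite set of users (flow types), $J$ a finite set of resources, resource $j$ has capacity $C_j>0$, and user $i$ can use exactly the resources in the nonempty set $J(i)\subseteq J$ (each route is a single resource). $\Lambda_i=n_ix_i$ is the total rate allocated to type $i$ ($n_i$ flows, each at rate $x_i$). Feasibility: $(\Lambda_i)_{i\in I}$ is feasible if there are $\Lambda_i^j\ge0$ ($i\in I$, $j\in J(i)$) with $\sum_{j\in J(i)}\Lambda_i^j=\Lambda_i$ for all $i\in I$ and $\sum_{i:j\in J(i)}\Lambda_i^j\le C_j$ for all $j\in J$. Notation: for $J'\subseteq J$, $I(J')=\{i\in I:J(i)\subseteq J'\}$. Connectivity: a pair $(I',J')$ with $I'\subseteq I$, $J'\subseteq J$ is connected if $J'$ cannot be partitioned into nonempty $J_1,J_2$ such that $I'$ can be partitioned into (possibly empty) $I_1,I_2$ with $J(i)\cap J_2=\emptyset$ for $i\in I_1$ and $J(i)\cap J_1=\emptyset$ for $i\in I_2$. A nonempty $J'\subseteq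 J$ is strongly connected if $(I(J'),J')$ is connected; $\mathscr{SC}(J)$ is the set of strongly connected subsets of $J$.
   Formalization: Part 2 is stated only for strongly connected sets J̃ with I(J̃) nonempty; for a single resource to which no user is confined, the constraint reads 0 ≤ C_j, always holds, and is redundant, so the literal claim fails there. *)

theory Defs
  imports Complex_Main
begin

text \<open>
  A network with routes of length one is given by a set \<open>I\<close> of users, a set \<open>J\<close> of
  resources, a map \<open>R\<close> assigning to a user \<open>i\<close> the set of resources it can use (written
  \<open>J(i)\<close> in the literature), and capacities \<open>C\<close>. Values of \<open>R\<close>, \<open>C\<close> and of an
  allocation outside \<open>I\<close> and \<open>J\<close> are irrelevant.
\<close>

definition feasible ::
  "'i set \<Rightarrow> 'j set \<Rightarrow> ('i \<Rightarrow> 'j set) \<Rightarrow> ('j \<Rightarrow> real) \<Rightarrow> ('i \<Rightarrow> real) \<Rightarrow> bool" where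
  "feasible I J R C \<Lambda> \<longleftrightarrow>
     (\<exists>L :: 'i \<Rightarrow> 'j \<Rightarrow> real.
        (\<forall>i\<in>I. \<forall>j\<in>R i. 0 \<le> L i j) \<and>
        (\<forall>i\<in>I. (\<Sum>j\<in>R i. L i j) = \<Lambda> i) \<and>
        (\<forall>j\<in>J. (\<Sum>i\<in>{i\<in>I. j \<in> R i}. L i j) \<le> C j))"

definition confined_users :: "'i set \<Rightarrow> ('i \<Rightarrow> 'j set) \<Rightarrow> 'j set \<Rightarrow> 'i set" where
  "confined_users I R J' = {i\<in>I. R i \<subseteq> J'}"

definition connected_pair :: "('i \<Rightarrow> 'j set) \<Rightarrow> 'i set \<Rightarrow> 'j set \<Rightarrow> bool" where
  "connected_pair R I' J' \<longleftrightarrow>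
     \<not> (\<exists>J1 J2. J1 \<noteq> {} \<and> J2 \<noteq> {} \<and> J1 \<inter> J2 = {} \<and> J1 \<union> J2 = J' \<and>
          (\<exists>I1 I2. I1 \<inter> I2 = {} \<and> I1 \<union> I2 = I' \<and>
             (\<forall>i\<in>I1. R i \<inter> J2 = {}) \<and> (\<forall>i\<in>I2. R i \<inter> J1 = {})))"

text \<open>
  Every singleton \<open>{j}\<close> with \<open>j \<in> J\<close> is strongly connected, even if no user is confined
  to it; the associated cut constraint is then the trivially true \<open>0 \<le> C j\<close>.
\<close>

definition strongly_connected_sets :: "'i set \<Rightarrow> 'j set \<Rightarrow> ('i \<Rightarrow> 'j set) \<Rightarrow> 'j set set" where
  "strongly_connected_sets I J R =
     {J'. J' \<subseteq> J \<and> J' \<noteq> {} \<and> connected_pair R (confined_users I R J') J'}"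

definition cut_constraint ::
  "'i set \<Rightarrow> ('i \<Rightarrow> 'j set) \<Rightarrow> ('j \<Rightarrow> real) \<Rightarrow> ('i \<Rightarrow> real) \<Rightarrow> 'j set \<Rightarrow> bool" where
  "cut_constraint I R C \<Lambda> J' \<longleftrightarrow> (\<Sum>i\<in>confined_users I R J'. \<Lambda> i) \<le> (\<Sum>j\<in>J'. C j)"

end

theory Submission
  imports Defs
begin

text \<open>
  Sufficiency of all cut constraints goes by induction on the number of pairs \<open>(i, j)\<close> with
  \<open>j \<in> R i\<close>. If some \<open>R i\<close> contains \<open>j\<close> and another resource, serve a part \<open>t\<close> of the rate of \<open>i\<close>
  at \<open>j\<close> and remove \<open>j\<close> from \<open>R i\<close>; a \<open>t\<close> preserving all cut constraints exists because the slack
  \<open>S \<mapsto> C(S) - \<Lambda>(I(S))\<close> is nonnegative and submodular. If all \<open>R i\<close> are singletons, the claim is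
  clear. The cut constraint of a set that is not strongly connected is implied by those of
  the two parts of a separation.

  For irredundancy of \<open>Jt\<close>, let every resource of \<open>Jt\<close> split its capacity evenly among the
  users confined to \<open>Jt\<close> that can use it. The constraint of \<open>Jt\<close> is then tight, and connectivity
  makes all others strict, so a slight increase of one rate violates only the constraint of \<open>Jt\<close>.
\<close>

section \<open>Necessity of the cut constraints by double counting\<close>

lemma finite_confined_users: "finite I \<Longrightarrow> finite (confined_users I R S)"
  by (simp add: confined_users_def)

text \<open>A user confined to \<open>S\<close> has all its resources in \<open>S\<close>, so the
  inner sum may run over \<open>S\<close> and the two sums can be exchanged.\<close>

lemma sum_confined_users_swap:
  fixes L :: "'i \<Rightarrow> 'j \<Rightarrow> real"
  assumes "finite I" and "finite S"
  shows "(\<Sum>i\<in>confined_users I R S. \<Sum>j\<in>R i. L i j)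
       = (\<Sum>j\<in>S. \<Sum>i\<in>{i\<in>confined_users I R S. j \<in> R i}. L i j)"
proof -
  have "(\<Sum>i\<in>confined_users I R S. \<Sum>j\<in>R i. L i j)
      = (\<Sum>i\<in>confined_users I R S. \<Sum>j\<in>{j\<in>S. j \<in> R i}. L i j)"
    by (intro sum.cong) (auto simp: confined_users_def)
  also have "\<dots> = (\<Sum>j\<in>S. \<Sum>i\<in>{i\<in>confined_users I R S. j \<in> R i}. L i j)"
    using assms by (intro sum.swap_restrict finite_confined_users)
  finally show ?thesis .
qed

text \<open>Users confined to \<open>S\<close> are served entirely by resources in \<open>S\<close>;
  whatever other users receive there is nonnegative and only takes up further capacity.\<close>

lemma cut_constraint_if_feasible:
  assumes "finite I" and "finite J" and "S \<subseteq> J" and "feasible I J R C \<Lambda>"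
  shows "cut_constraint I R C \<Lambda> S"
proof -
  obtain L where nn: "\<forall>i\<in>I. \<forall>j\<in>R i. 0 \<le> L i j"
    and rate: "\<forall>i\<in>I. (\<Sum>j\<in>R i. L i j) = \<Lambda> i"
    and cap: "\<forall>j\<in>J. (\<Sum>i\<in>{i\<in>I. j \<in> R i}. L i j) \<le> C j"
    using assms(4) unfolding feasible_def by blast
  have "(\<Sum>i\<in>confined_users I R S. \<Lambda> i) = (\<Sum>i\<in>confined_users I R S. \<Sum>j\<in>R i. L i j)"
    by (rule sum.cong) (use rate in \<open>auto simp: confined_users_def\<close>)
  also have "\<dots> = (\<Sum>j\<in>S. \<Sum>i\<in>{i\<in>confined_users I R S. j \<in> R i}. L i j)"
    using assms finite_subset by (intro sum_confined_users_swap) auto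
  also have "\<dots> \<le> (\<Sum>j\<in>S. \<Sum>i\<in>{i\<in>I. j \<in> R i}. L i j)"
    using assms(1) nn by (intro sum_mono sum_mono2) (auto simp: confined_users_def)
  also have "\<dots> \<le> (\<Sum>j\<in>S. C j)"
    using cap assms(3) by (intro sum_mono) auto
  finally show ?thesis by (simp add: cut_constraint_def)
qed

section \<open>Reduction to strongly connected sets\<close>

lemma cut_constraint_empty: "(\<And>i. i \<in> I \<Longrightarrow> R i \<noteq> {}) \<Longrightarrow> cut_constraint I R C \<Lambda> {}"
  by (auto simp: cut_constraint_def confined_users_def intro!: sum_nonpos)

text \<open>Both parts of a separation are nonempty, hence proper subsets, so induction on the
  finite set \<open>S\<close> descends until only strongly connected or empty sets remain.\<close>

lemma cut_constraint_if_strongly_connected: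
  assumes "finite I" and "finite J"
    and ne: "\<And>i. i \<in> I \<Longrightarrow> R i \<noteq> {}"
    and nonneg: "\<And>i. i \<in> I \<Longrightarrow> 0 \<le> \<Lambda> i"
    and sc: "\<And>S. S \<in> strongly_connected_sets I J R \<Longrightarrow> cut_constraint I R C \<Lambda> S"
    and "S \<subseteq> J"
  shows "cut_constraint I R C \<Lambda> S"
proof -
  have "finite S" using assms finite_subset by blast
  then show ?thesis using \<open>S \<subseteq> J\<close>
  proof (induction rule: finite_psubset_induct)
    case (psubset S)
    show ?case
    proof (cases "S = {} \<or> S \<in> strongly_connected_sets I J R")
      case True
      then show ?thesis using sc cut_constraint_empty[of I R, OF ne] by blast
    next
      case False
      then have "\<not> connected_pair R (confined_users I R S) S"
        using psubset.prems by (auto simp: strongly_connected_sets_def)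
      then obtain J1 J2 I1 I2 where J12: "J1 \<noteq> {}" "J2 \<noteq> {}" "J1 \<inter> J2 = {}" "J1 \<union> J2 = S"
        and I12: "I1 \<inter> I2 = {}" "I1 \<union> I2 = confined_users I R S"
          "\<forall>i\<in>I1. R i \<inter> J2 = {}" "\<forall>i\<in>I2. R i \<inter> J1 = {}"
        unfolding connected_pair_def not_not by (elim exE conjE) (rule that)
      have fin: "finite J1" "finite J2" "finite I1" "finite I2"
        using psubset.hyps J12 I12(2) finite_confined_users[OF assms(1), of R S]
        by (metis finite_Un)+
      \<comment> \<open>A user of \<open>I1\<close> has its resources in
        \<open>J1 \<union> J2\<close> and avoids \<open>J2\<close>, so it is confined to
        \<open>J1\<close>; symmetrically for \<open>I2\<close>.\<close>
      have sub: "I1 \<subseteq> confined_users I R J1" "I2 \<subseteq> confined_users I R J2"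
        using I12(2-4) J12(4) by (fastforce simp: confined_users_def)+
      have "J1 \<subset> S" "J2 \<subset> S" using J12 by auto
      then have cut: "cut_constraint I R C \<Lambda> J1" "cut_constraint I R C \<Lambda> J2"
        using psubset by auto
      have "(\<Sum>i\<in>confined_users I R S. \<Lambda> i) = (\<Sum>i\<in>I1. \<Lambda> i) + (\<Sum>i\<in>I2. \<Lambda> i)"
        using I12 fin by (metis sum.union_disjoint)
      also have "\<dots> \<le> (\<Sum>i\<in>confined_users I R J1. \<Lambda> i) + (\<Sum>i\<in>confined_users I R J2. \<Lambda> i)"
        using sub nonneg assms(1)
        by (intro add_mono sum_mono2 finite_confined_users) (auto simp: confined_users_def)
      also have "\<dots> \<le> (\<Sum>j\<in>J1. C j) + (\<Sum>j\<in>J2. C j)"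
        using cut by (simp add: cut_constraint_def)
      also have "\<dots> = (\<Sum>j\<in>S. C j)"
        using J12 fin by (metis sum.union_disjoint)
      finally show ?thesis by (simp add: cut_constraint_def)
    qed
  qed
qed

section \<open>Sufficiency of the cut constraints\<close>

text \<open>This undoes one reduction step: user \<open>i\<close> additionally receives
  \<open>t\<close> at \<open>j\<close>, which costs exactly the capacity withheld there.\<close>

lemma feasible_remove_route:
  assumes "finite I" and "finite J" and "i \<in> I" and "j \<in> R i" and "R i \<subseteq> J" and "0 \<le> t"
    and feas: "feasible I J (R(i := R i - {j})) (C(j := C j - t)) (\<Lambda>(i := \<Lambda> i - t))"
  shows "feasible I J R C \<Lambda>"
proof -
  let ?R = "R(i := R i - {j})" and ?C = "C(j := C j - t)" and ?\<Lambda> = "\<Lambda>(i := \<Lambda> i - t)"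
  obtain L where nn: "\<forall>k\<in>I. \<forall>l\<in>?R k. 0 \<le> L k l"
    and rate: "\<forall>k\<in>I. (\<Sum>l\<in>?R k. L k l) = ?\<Lambda> k"
    and cap: "\<forall>l\<in>J. (\<Sum>k\<in>{k\<in>I. l \<in> ?R k}. L k l) \<le> ?C l"
    using feas unfolding feasible_def by blast
  \<comment> \<open>\<open>L i j\<close> is unconstrained, as \<open>j\<close> has been removed from
    the resources of \<open>i\<close>; it is therefore overwritten by \<open>t\<close> rather than
    increased.\<close>
  define M where "M k l = (if k = i \<and> l = j then t else L k l)" for k l
  have "0 \<le> M k l" if "k \<in> I" "l \<in> R k" for k l
    using nn that \<open>0 \<le> t\<close> by (auto simp: M_def split: if_splits)
  moreover have "(\<Sum>l\<in>R k. M k l) = \<Lambda> k" if "k \<in> I" for k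
  proof (cases "k = i")
    case True
    have "(\<Sum>l\<in>R i. M i l) = M i j + (\<Sum>l\<in>R i - {j}. M i l)"
      using assms finite_subset by (intro sum.remove) auto
    also have "(\<Sum>l\<in>R i - {j}. M i l) = (\<Sum>l\<in>R i - {j}. L i l)"
      by (intro sum.cong) (auto simp: M_def)
    also have "\<dots> = \<Lambda> i - t"
      using rate \<open>i \<in> I\<close> by force
    finally show ?thesis by (simp add: M_def True)
  next
    case False
    then show ?thesis using rate that by (auto simp: M_def)
  qed
  moreover have "(\<Sum>k\<in>{k\<in>I. l \<in> R k}. M k l) \<le> C l" if "l \<in> J" for l
  proof (cases "l = j")
    case True
    have eq: "{k\<in>I. j \<in> R k} - {i} = {k\<in>I. j \<in> ?R k}" by auto
    have "(\<Sum>k\<in>{k\<in>I. j \<in> R k}. M k j) = M i j + (\<Sum>k\<in>{k\<in>I. j \<in> R k} - {i}. M k j)"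
      using assms by (intro sum.remove) auto
    also have "(\<Sum>k\<in>{k\<in>I. j \<in> R k} - {i}. M k j) = (\<Sum>k\<in>{k\<in>I. j \<in> ?R k}. L k j)"
      unfolding eq by (intro sum.cong) (auto simp: M_def)
    also have "\<dots> \<le> C j - t"
      using bspec[OF cap that] True by simp
    finally show ?thesis by (simp add: M_def True)
  next
    case False
    have "(\<Sum>k\<in>{k\<in>I. l \<in> R k}. M k l) = (\<Sum>k\<in>{k\<in>I. l \<in> ?R k}. L k l)"
      using False by (intro sum.cong) (auto simp: M_def)
    then show ?thesis using bspec[OF cap that] False by simp
  qed
  ultimately show ?thesis unfolding feasible_def by blast
qed

lemma sum_fun_upd_diff:
  fixes g :: "'a \<Rightarrow> real"
  assumes "finite X"
  shows "sum (g(x := g x - t)) X = sum g X - (if x \<in> X then t else 0)"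
proof -
  have "sum (g(x := g x - t)) X = (\<Sum>y\<in>X. g y - (if x = y then t else 0))"
    by (intro sum.cong) auto
  then show ?thesis using assms by (simp add: sum_subtractf)
qed

text \<open>A reduction step changes \<open>R\<close>, \<open>C\<close> and
  \<open>\<Lambda>\<close>, so all three are generalised. Assuming the constraint for every subset
  of \<open>J\<close> keeps the hypothesis independent of strong connectivity, which varies with
  \<open>R\<close>.\<close>

lemma feasible_if_cut_constraints:
  assumes "finite I" and "finite J"
    and "\<And>i. i \<in> I \<Longrightarrow> R i \<noteq> {} \<and> R i \<subseteq> J"
    and "\<And>i. i \<in> I \<Longrightarrow> 0 \<le> \<Lambda> i"
    and "\<And>S. S \<subseteq> J \<Longrightarrow> cut_constraint I R C \<Lambda> S"
  shows "feasible I J R C \<Lambda>"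
  using assms(3-)
proof (induction "\<Sum>i\<in>I. card (R i)" arbitrary: R C \<Lambda> rule: less_induct)
  case less
  have routes: "R i \<noteq> {}" "R i \<subseteq> J" and nonneg: "0 \<le> \<Lambda> i" if "i \<in> I" for i
    using less.prems that by auto
  have cut: "(\<Sum>i\<in>confined_users I R S. \<Lambda> i) \<le> sum C S" if "S \<subseteq> J" for S
    using less.prems(3)[OF that] by (simp add: cut_constraint_def)
  show ?case
  proof (cases "\<exists>i\<in>I. \<exists>j\<in>R i. R i \<noteq> {j}")
    case False
    \<comment> \<open>The witness, found by unification, is
      \<open>\<lambda>i j. \<Lambda> i\<close>: the single resource of \<open>i\<close> carries its
      whole rate.\<close>
    have "feasible I J R C \<Lambda>" unfolding feasible_def
    proof (intro exI conjI ballI)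
      fix i assume i: "i \<in> I"
      show "0 \<le> \<Lambda> i" using nonneg i .
      obtain j where "R i = {j}" using False i routes(1)[OF i] by blast
      then show "(\<Sum>j\<in>R i. \<Lambda> i) = \<Lambda> i" by simp
    next
      fix j assume "j \<in> J"
      have "{i\<in>I. j \<in> R i} = confined_users I R {j}"
        using False routes(1) by (fastforce simp: confined_users_def)
      then show "(\<Sum>i\<in>{i\<in>I. j \<in> R i}. \<Lambda> i) \<le> C j"
        using cut[of "{j}"] \<open>j \<in> J\<close> by simp
    qed
    then show ?thesis .
  next
    case True
    then obtain i j where i: "i \<in> I" and j: "j \<in> R i" and Ri: "R i \<noteq> {j}" by blast
    note finJ = finite_subset[OF _ \<open>finite J\<close>]
    \<comment> \<open>Serving \<open>t\<close> at \<open>j\<close> lowers the slack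
      \<open>f S\<close> by \<open>t\<close> for \<open>S\<close> in \<open>\<A>\<close>, and by
      \<open>\<Lambda> i - t\<close> if \<open>j \<notin> S\<close> and
      \<open>R i - {j} \<subseteq> S\<close>, because \<open>i\<close> then becomes confined to
      \<open>S\<close>. All other slacks stay the same.\<close>
    define f where "f S = sum C S - (\<Sum>k\<in>confined_users I R S. \<Lambda> k)" for S
    define \<A> where "\<A> = {A. A \<subseteq> J \<and> j \<in> A \<and> \<not> R i \<subseteq> A}"
    \<comment> \<open>The largest admissible value: the bounds from \<open>\<A>\<close> keep those
      slacks nonnegative, and \<open>\<Lambda> i\<close> keeps the remaining rate of
      \<open>i\<close> nonnegative.\<close>
    define t where "t = Min (insert (\<Lambda> i) (f ` \<A>))"
    have f_nonneg: "0 \<le> f S" if "S \<subseteq> J" for S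
      using cut[OF that] by (simp add: f_def)
    have "finite \<A>"
      using \<open>finite J\<close> by (auto simp: \<A>_def intro: finite_subset[of _ "Pow J"])
    then have fin: "finite (insert (\<Lambda> i) (f ` \<A>))" by simp
    have t_le: "t \<le> \<Lambda> i" and t_le_f: "\<And>A. A \<in> \<A> \<Longrightarrow> t \<le> f A"
      unfolding t_def using fin by auto
    have "0 \<le> t"
      unfolding t_def using fin nonneg[OF i] f_nonneg by (auto simp: \<A>_def)
    \<comment> \<open>Submodularity with a gain: \<open>i\<close> is confined to
      \<open>A \<union> B\<close> but to neither \<open>A\<close> nor \<open>B\<close>, so its rate
      enters in addition. Hence each lower bound \<open>\<Lambda> i - f B\<close> on
      \<open>t\<close> is at most each upper bound \<open>f A\<close>.\<close>
    have submod: "\<Lambda> i \<le> f A + f B" if A: "A \<in> \<A>" and B: "B \<subseteq> J" "j \<notin> B" "R i - {j} \<subseteq> B" for A B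
    proof -
      let ?K = "confined_users I R"
      have AB: "A \<subseteq> J" "j \<in> A" "\<not> R i \<subseteq> A" using A by (auto simp: \<A>_def)
      have ix: "i \<in> ?K (A \<union> B)" "i \<notin> ?K A" "i \<notin> ?K B"
        using i j AB B by (auto simp: confined_users_def)
      have "sum \<Lambda> (?K A) + sum \<Lambda> (?K B) + \<Lambda> i
          = sum \<Lambda> (?K A \<union> ?K B) + sum \<Lambda> (?K A \<inter> ?K B) + \<Lambda> i"
        using assms(1) by (simp add: sum.union_inter finite_confined_users)
      also have "\<dots> = sum \<Lambda> (insert i (?K A \<union> ?K B)) + sum \<Lambda> (?K (A \<inter> B))"
      proof -
        have "?K A \<inter> ?K B = ?K (A \<inter> B)" by (auto simp: confined_users_def)
        then show ?thesis using assms(1) ix by (simp add: finite_confined_users)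
      qed
      also have "\<dots> \<le> sum \<Lambda> (?K (A \<union> B)) + sum \<Lambda> (?K (A \<inter> B))"
        using assms(1) ix nonneg
        by (intro add_right_mono sum_mono2 finite_confined_users) (auto simp: confined_users_def)
      also have "\<dots> \<le> sum C (A \<union> B) + sum C (A \<inter> B)"
        using AB B by (intro add_mono cut) auto
      also have "\<dots> = sum C A + sum C B"
        using finJ AB(1) B(1) by (intro sum.union_inter) auto
      finally show ?thesis by (simp add: f_def)
    qed
    have t_ge: "\<Lambda> i - f B \<le> t" if "B \<subseteq> J" "j \<notin> B" "R i - {j} \<subseteq> B" for B
    proof -
      have "\<Lambda> i - f B \<le> x" if x: "x \<in> insert (\<Lambda> i) (f ` \<A>)" for x
        using x f_nonneg[OF \<open>B \<subseteq> J\<close>] submod[OF _ \<open>B \<subseteq> J\<close> \<open>j \<notin> B\<close> \<open>R i - {j} \<subseteq> B\<close>] by force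
      then show ?thesis unfolding t_def using fin by (subst Min_ge_iff) auto
    qed
    let ?R = "R(i := R i - {j})" and ?C = "C(j := C j - t)" and ?\<Lambda> = "\<Lambda>(i := \<Lambda> i - t)"
    have "feasible I J ?R ?C ?\<Lambda>"
    proof (rule less.hyps)
      have "card (R i - {j}) < card (R i)"
        using j finJ[OF routes(2)[OF i]] by (intro psubset_card_mono) auto
      then show "(\<Sum>k\<in>I. card (?R k)) < (\<Sum>k\<in>I. card (R k))"
        using i by (intro sum_strict_mono_ex1[OF assms(1)]) (auto intro!: bexI[of _ i])
      show "?R k \<noteq> {} \<and> ?R k \<subseteq> J" if "k \<in> I" for k
        using routes[OF that] j Ri by auto
      show "0 \<le> ?\<Lambda> k" if "k \<in> I" for k
        using nonneg[OF that] t_le by auto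
      show "cut_constraint I ?R ?C ?\<Lambda> S" if "S \<subseteq> J" for S
      proof -
        let ?K = "confined_users I R S"
        have K: "confined_users I ?R S = (if R i - {j} \<subseteq> S then insert i ?K else ?K)"
          using i by (auto simp: confined_users_def split: if_splits)
        have fK: "finite ?K" by (rule finite_confined_users[OF assms(1)])
        have iK: "i \<in> ?K \<longleftrightarrow> R i \<subseteq> S" using i by (simp add: confined_users_def)
        have fS: "0 \<le> f S" using f_nonneg[OF that] .
        have sum_rates: "sum ?\<Lambda> (confined_users I ?R S)
            = sum \<Lambda> (confined_users I ?R S) - (if i \<in> confined_users I ?R S then t else 0)"
          and sum_caps: "sum ?C S = sum C S - (if j \<in> S then t else 0)"
          by (rule sum_fun_upd_diff[OF finite_confined_users[OF assms(1)]],
              rule sum_fun_upd_diff[OF finJ[OF that]])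
        \<comment> \<open>In the first and last case \<open>t\<close> is subtracted on both sides or
          on neither; the second case uses \<open>t_le_f\<close> and the third
          \<open>t_ge\<close>.\<close>
        consider "R i \<subseteq> S" | "\<not> R i \<subseteq> S" "j \<in> S" | "R i - {j} \<subseteq> S" "j \<notin> S"
          | "\<not> R i - {j} \<subseteq> S" "j \<notin> S"
          by blast
        then have "sum ?\<Lambda> (confined_users I ?R S) \<le> sum ?C S"
        proof cases
          case 1
          then have "confined_users I ?R S = ?K" using K iK by auto
          then show ?thesis unfolding sum_rates sum_caps using 1 fS j iK by (auto simp: f_def)
        next
          case 2
          then have "\<not> R i - {j} \<subseteq> S" by blast
          then have "confined_users I ?R S = ?K" using K by simp
          moreover have "t \<le> f S" using 2 that by (intro t_le_f) (simp add: \<A>_def)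
          ultimately show ?thesis unfolding sum_rates sum_caps using 2 iK by (simp add: f_def)
        next
          case 3
          then have "i \<notin> ?K" using iK j by auto
          moreover have "confined_users I ?R S = insert i ?K" using 3 K by simp
          ultimately show ?thesis
            unfolding sum_rates sum_caps using 3 t_ge[OF that] fK by (simp add: f_def)
        next
          case 4
          then have "confined_users I ?R S = ?K" "i \<notin> ?K" using K iK by auto
          then show ?thesis unfolding sum_rates sum_caps using 4 fS by (simp add: f_def)
        qed
        then show ?thesis by (simp add: cut_constraint_def)
      qed
    qed
    then show ?thesis
      using feasible_remove_route assms(1,2) i j routes(2)[OF i] \<open>0 \<le> t\<close> by metis
  qed
qed

section \<open>Irredundancy of the cut constraints\<close>

text \<open>If every user of \<open>K\<close> missed \<open>S\<close> or \<open>T - S\<close>,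
  sorting the users by the part they miss would separate \<open>T\<close>.\<close>

lemma connected_pair_crossing:
  assumes "connected_pair R K T" and "S \<subset> T" and "S \<noteq> {}"
  obtains i where "i \<in> K" and "R i \<inter> S \<noteq> {}" and "R i \<inter> (T - S) \<noteq> {}"
proof (rule ccontr)
  assume contra: "\<not> thesis"
  have no: "R i \<inter> S = {} \<or> R i \<inter> (T - S) = {}" if "i \<in> K" for i
    using contra \<open>i \<in> K\<close>
      \<open>\<And>i. i \<in> K \<Longrightarrow> R i \<inter> S \<noteq> {} \<Longrightarrow> R i \<inter> (T - S) \<noteq> {} \<Longrightarrow> thesis\<close>
    by blast
  let ?I1 = "{i\<in>K. R i \<inter> (T - S) = {}}"
  have "\<not> connected_pair R K T"
    unfolding connected_pair_def not_not
  proof (intro exI conjI)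
    show "S \<noteq> {}" "T - S \<noteq> {}" "S \<inter> (T - S) = {}" "S \<union> (T - S) = T"
      using assms(2,3) by auto
    show "?I1 \<inter> (K - ?I1) = {}" "?I1 \<union> (K - ?I1) = K" "\<forall>i\<in>?I1. R i \<inter> (T - S) = {}"
      by auto
    show "\<forall>i\<in>K - ?I1. R i \<inter> S = {}"
      using no by auto
  qed
  then show False
    using assms(1) by contradiction
qed

lemma tight_only_at_strongly_connected:
  fixes I :: "'i set" and J :: "'j set" and R :: "'i \<Rightarrow> 'j set" and C :: "'j \<Rightarrow> real"
  assumes "finite I" and "finite J"
    and pos: "\<And>j. j \<in> J \<Longrightarrow> 0 < C j"
    and routes: "\<And>i. i \<in> I \<Longrightarrow> R i \<noteq> {}"
    and T: "T \<in> strongly_connected_sets I J R" and ne: "confined_users I R T \<noteq> {}"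
  shows "\<exists>\<Lambda> :: 'i \<Rightarrow> real. (\<forall>i\<in>I. 0 \<le> \<Lambda> i) \<and>
    (\<Sum>i\<in>confined_users I R T. \<Lambda> i) = sum C T \<and>
    (\<forall>S\<subseteq>J. S \<noteq> {} \<longrightarrow> S \<noteq> T \<longrightarrow> (\<Sum>i\<in>confined_users I R S. \<Lambda> i) < sum C S)"
proof -
  let ?K = "confined_users I R T"
  have TJ: "T \<subseteq> J" "T \<noteq> {}" and conn: "connected_pair R ?K T"
    using T by (auto simp: strongly_connected_sets_def)
  have finT: "finite T" using TJ assms finite_subset by blast
  have finK: "finite ?K" by (rule finite_confined_users[OF assms(1)])
  \<comment> \<open>This keeps the divisor in \<open>L\<close> nonzero. For \<open>T = {j}\<close>
    any user confined to \<open>T\<close> will do; otherwise connectivity gives one linking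
    \<open>j\<close> to the rest of \<open>T\<close>.\<close>
  have covered: "{i\<in>?K. j \<in> R i} \<noteq> {}" if "j \<in> T" for j
  proof (cases "T = {j}")
    case True
    obtain i where "i \<in> ?K" using ne by auto
    then have "i \<in> {i\<in>?K. j \<in> R i}" using routes[of i] True by (auto simp: confined_users_def)
    then show ?thesis by blast
  next
    case False
    then have "{j} \<subset> T" using that by auto
    then obtain i where "i \<in> ?K" "R i \<inter> {j} \<noteq> {}"
      using connected_pair_crossing[OF conn] by (metis insert_not_empty)
    then show ?thesis by auto
  qed
  define L where "L i j = C j / card {i\<in>?K. j \<in> R i}" for i :: 'i and j
  have L_pos: "0 < L i j" if "j \<in> T" for i j
  proof -
    have "0 < card {i\<in>?K. j \<in> R i}"
      using covered[OF that] finK by (subst card_gt_0_iff) auto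
    then show ?thesis using pos[of j] that TJ(1) by (auto simp: L_def)
  qed
  have L_sum: "(\<Sum>i\<in>{i\<in>?K. j \<in> R i}. L i j) = C j" if "j \<in> T" for j
    using covered[OF that] finK by (auto simp: L_def card_eq_0_iff)
  define \<Lambda> where "\<Lambda> i = (if i \<in> ?K then \<Sum>j\<in>R i. L i j else 0)" for i
  have sum_sub: "(\<Sum>i\<in>confined_users I R S. \<Lambda> i)
      = (\<Sum>j\<in>S. \<Sum>i\<in>{i\<in>confined_users I R S. j \<in> R i}. L i j)" if "S \<subseteq> T" for S
  proof -
    have "(\<Sum>i\<in>confined_users I R S. \<Lambda> i) = (\<Sum>i\<in>confined_users I R S. \<Sum>j\<in>R i. L i j)"
      by (rule sum.cong) (use that in \<open>auto simp: \<Lambda>_def confined_users_def\<close>)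
    also have "\<dots> = (\<Sum>j\<in>S. \<Sum>i\<in>{i\<in>confined_users I R S. j \<in> R i}. L i j)"
      using assms(1) finite_subset[OF that finT] by (rule sum_confined_users_swap)
    finally show ?thesis .
  qed
  have mono: "(\<Sum>i\<in>{i\<in>confined_users I R S. j \<in> R i}. L i j) \<le> C j" if "S \<subseteq> T" "j \<in> S" for S j
  proof -
    have "j \<in> T" using that by auto
    have "(\<Sum>i\<in>{i\<in>confined_users I R S. j \<in> R i}. L i j) \<le> (\<Sum>i\<in>{i\<in>?K. j \<in> R i}. L i j)"
      using assms(1) that L_pos[OF \<open>j \<in> T\<close>]
      by (intro sum_mono2) (auto simp: confined_users_def intro: less_imp_le)
    then show ?thesis using L_sum[OF \<open>j \<in> T\<close>] by simp
  qed
  have strict: "(\<Sum>i\<in>confined_users I R S. \<Lambda> i) < sum C S" if "S \<subset> T" "S \<noteq> {}" for S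
  proof -
    \<comment> \<open>The crossing user takes a positive share of some \<open>j\<close> in
      \<open>S\<close> without being confined to \<open>S\<close>, so the users confined to
      \<open>S\<close> do not exhaust \<open>j\<close>.\<close>
    obtain i where i: "i \<in> ?K" "R i \<inter> S \<noteq> {}" "R i \<inter> (T - S) \<noteq> {}"
      by (rule connected_pair_crossing[OF conn \<open>S \<subset> T\<close> \<open>S \<noteq> {}\<close>])
    then obtain j where j: "j \<in> R i" "j \<in> S" by blast
    have jT: "j \<in> T" using j that by auto
    have "(\<Sum>i\<in>{i\<in>confined_users I R S. j \<in> R i}. L i j) < (\<Sum>i\<in>{i\<in>?K. j \<in> R i}. L i j)"
      using assms(1) that i j L_pos[OF jT]
      by (intro sum_strict_mono2[where b = i]) (auto simp: confined_users_def intro: less_imp_le)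
    then have "(\<Sum>i\<in>{i\<in>confined_users I R S. j \<in> R i}. L i j) < C j"
      using L_sum[OF jT] by simp
    then show ?thesis
      using that j mono[of S] finite_subset[OF _ finT, of S]
      by (subst sum_sub) (auto intro!: sum_strict_mono_ex1)
  qed
  show ?thesis
  proof (intro exI[of _ \<Lambda>] conjI ballI allI impI)
    show "0 \<le> \<Lambda> i" if "i \<in> I" for i
      using L_pos by (auto simp: \<Lambda>_def confined_users_def intro!: sum_nonneg intro: less_imp_le)
    show tight: "(\<Sum>i\<in>?K. \<Lambda> i) = sum C T"
      using L_sum by (simp add: sum_sub)
    fix S assume S: "S \<subseteq> J" "S \<noteq> {}" "S \<noteq> T"
    have finS: "finite S" using S assms finite_subset by blast
    have le: "sum C (S \<inter> T) \<le> sum C S"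
      using finS S pos by (intro sum_mono2) (auto intro: less_imp_le)
    \<comment> \<open>Users not confined to \<open>T\<close> have rate 0, so only the trace of
      \<open>S\<close> on \<open>T\<close> matters.\<close>
    have "(\<Sum>i\<in>confined_users I R S. \<Lambda> i) = (\<Sum>i\<in>confined_users I R (S \<inter> T). \<Lambda> i)"
      using assms(1)
      by (intro sum.mono_neutral_right finite_confined_users) (auto simp: confined_users_def \<Lambda>_def)
    also have "\<dots> < sum C S"
    proof (cases "S \<inter> T = {} \<or> T \<subseteq> S")
      case True
      \<comment> \<open>Here \<open>S \<inter> T\<close> is empty or all of \<open>T\<close>, where
        equality holds; strictness comes from the positive capacity of a resource in
        \<open>S\<close> outside \<open>T\<close>.\<close>
      then obtain s where "s \<in> S - T" using S by blast
      then have less: "sum C (S \<inter> T) < sum C S"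
        using finS S(1) pos by (intro sum_strict_mono2[where b = s]) (auto intro: less_imp_le)
      have "(\<Sum>i\<in>confined_users I R (S \<inter> T). \<Lambda> i) = sum C (S \<inter> T)"
      proof (cases "S \<inter> T = {}")
        case True
        have "confined_users I R {} = {}" using routes by (auto simp: confined_users_def)
        then show ?thesis using True by simp
      next
        case False
        then have "S \<inter> T = T" using \<open>S \<inter> T = {} \<or> T \<subseteq> S\<close> by auto
        then show ?thesis using tight by simp
      qed
      also note less
      finally show ?thesis .
    next
      case False
      then have "S \<inter> T \<subset> T" "S \<inter> T \<noteq> {}" by auto
      then show ?thesis using strict[of "S \<inter> T"] le by linarith
    qed
    finally show "(\<Sum>i\<in>confined_users I R S. \<Lambda> i) < sum C S" .
  qed
qed

text \<open>There are finitely many other nonempty sets and all have positive slack, so the rate of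
  one user confined to \<open>T\<close> can be raised by the least slack; the tight constraint of
  \<open>T\<close> then fails.\<close>

lemma cut_constraint_irredundant:
  fixes I :: "'i set" and J :: "'j set" and R :: "'i \<Rightarrow> 'j set" and C :: "'j \<Rightarrow> real"
  assumes "finite I" and "finite J"
    and pos: "\<And>j. j \<in> J \<Longrightarrow> 0 < C j"
    and routes: "\<And>i. i \<in> I \<Longrightarrow> R i \<noteq> {}"
    and T: "T \<in> strongly_connected_sets I J R" and ne: "confined_users I R T \<noteq> {}"
  shows "\<exists>\<Lambda> :: 'i \<Rightarrow> real. (\<forall>i\<in>I. 0 \<le> \<Lambda> i) \<and>
    (\<forall>S\<subseteq>J. S \<noteq> T \<longrightarrow> cut_constraint I R C \<Lambda> S) \<and> \<not> cut_constraint I R C \<Lambda> T"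
proof -
  obtain \<Lambda> :: "'i \<Rightarrow> real" where \<Lambda>: "(\<forall>i\<in>I. 0 \<le> \<Lambda> i) \<and>
    (\<Sum>i\<in>confined_users I R T. \<Lambda> i) = sum C T \<and>
    (\<forall>S\<subseteq>J. S \<noteq> {} \<longrightarrow> S \<noteq> T \<longrightarrow> (\<Sum>i\<in>confined_users I R S. \<Lambda> i) < sum C S)"
    using tight_only_at_strongly_connected[where C = C, OF assms] ..
  have nonneg: "0 \<le> \<Lambda> i" if "i \<in> I" for i
    using \<Lambda> that by simp
  have tight: "(\<Sum>i\<in>confined_users I R T. \<Lambda> i) = sum C T"
    using \<Lambda> by simp
  have strict: "(\<Sum>i\<in>confined_users I R S. \<Lambda> i) < sum C S" if "S \<subseteq> J" "S \<noteq> {}" "S \<noteq> T" for S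
    using \<Lambda> that by simp
  obtain u where u: "u \<in> confined_users I R T" using ne by blast
  \<comment> \<open>The element 1 is an arbitrary positive value; it keeps \<open>D\<close> nonempty
    when \<open>T\<close> is the only nonempty subset of \<open>J\<close>.\<close>
  define D where "D = insert 1
    ((\<lambda>S. sum C S - (\<Sum>i\<in>confined_users I R S. \<Lambda> i))
      ` {S. S \<subseteq> J \<and> S \<noteq> {} \<and> S \<noteq> T})"
  have "finite D"
    using \<open>finite J\<close> by (auto simp: D_def)
  define d where "d = Min D"
  have "D \<noteq> {}" by (simp add: D_def)
  have "\<forall>x\<in>D. 0 < x" using strict by (auto simp: D_def)
  then have d_pos: "0 < d" using \<open>finite D\<close> \<open>D \<noteq> {}\<close> by (simp add: d_def)
  have d_le: "(\<Sum>i\<in>confined_users I R S. \<Lambda> i) + d \<le> sum C S" if "S \<subseteq> J" "S \<noteq> {}" "S \<noteq> T" for S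
  proof -
    have "d \<le> sum C S - (\<Sum>i\<in>confined_users I R S. \<Lambda> i)"
      unfolding d_def using that by (intro Min_le \<open>finite D\<close>) (auto simp: D_def)
    then show ?thesis by simp
  qed
  define \<Lambda>' where "\<Lambda>' i = \<Lambda> i + (if u = i then d else 0)" for i
  have sum': "(\<Sum>i\<in>confined_users I R S. \<Lambda>' i)
      = (\<Sum>i\<in>confined_users I R S. \<Lambda> i) + (if u \<in> confined_users I R S then d else 0)" for S
    using finite_confined_users[OF assms(1), of R S] by (simp add: \<Lambda>'_def sum.distrib)
  show ?thesis
  proof (intro exI[of _ \<Lambda>'] conjI ballI allI impI)
    show "0 \<le> \<Lambda>' i" if "i \<in> I" for i
      using nonneg[OF that] d_pos by (simp add: \<Lambda>'_def)
    show "\<not> cut_constraint I R C \<Lambda>' T"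
      using u tight d_pos by (simp add: cut_constraint_def sum')
    show "cut_constraint I R C \<Lambda>' S" if "S \<subseteq> J" "S \<noteq> T" for S
    proof (cases "S = {}")
      case True
      then show ?thesis using cut_constraint_empty[of I R] routes by blast
    next
      case False
      then show ?thesis using d_le[OF that(1) False that(2)] d_pos by (auto simp: cut_constraint_def sum')
    qed
  qed
qed

text \<open>Irredundancy is restricted to sets with a confined user. A strongly connected set
  without one is a singleton \<open>{j}\<close>, as any larger set separates trivially; its
  constraint \<open>0 \<le> C j\<close> always holds, so dropping it cannot admit an infeasible
  allocation.\<close>

theorem lemmaA1:
  fixes I :: "'i set" and J :: "'j set" and R :: "'i \<Rightarrow> 'j set" and C :: "'j \<Rightarrow> real"
  assumes "finite I" and "finite J"
    and "\<And>j. j \<in> J \<Longrightarrow> 0 < C j"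
    and "\<And>i. i \<in> I \<Longrightarrow> R i \<noteq> {} \<and> R i \<subseteq> J"
  shows "(\<forall>\<Lambda> :: 'i \<Rightarrow> real. (\<forall>i\<in>I. 0 \<le> \<Lambda> i) \<longrightarrow>
            (feasible I J R C \<Lambda> \<longleftrightarrow>
             (\<forall>J'\<in>strongly_connected_sets I J R. cut_constraint I R C \<Lambda> J')))
       \<and> (\<forall>Jt\<in>strongly_connected_sets I J R. confined_users I R Jt \<noteq> {} \<longrightarrow>
            (\<exists>\<Lambda> :: 'i \<Rightarrow> real. (\<forall>i\<in>I. 0 \<le> \<Lambda> i) \<and>
               (\<forall>J'\<in>strongly_connected_sets I J R - {Jt}. cut_constraint I R C \<Lambda> J') \<and>
               \<not> feasible I J R C \<Lambda>))"
proof (intro conjI allI ballI impI)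
  fix \<Lambda> :: "'i \<Rightarrow> real" assume nonneg: "\<forall>i\<in>I. 0 \<le> \<Lambda> i"
  show "feasible I J R C \<Lambda> \<longleftrightarrow> (\<forall>J'\<in>strongly_connected_sets I J R. cut_constraint I R C \<Lambda> J')"
  proof (intro iffI ballI)
    fix S assume "feasible I J R C \<Lambda>" and "S \<in> strongly_connected_sets I J R"
    then show "cut_constraint I R C \<Lambda> S"
      using cut_constraint_if_feasible[OF assms(1,2)] by (auto simp: strongly_connected_sets_def)
  next
    assume sc: "\<forall>J'\<in>strongly_connected_sets I J R. cut_constraint I R C \<Lambda> J'"
    show "feasible I J R C \<Lambda>"
    proof (rule feasible_if_cut_constraints[OF assms(1,2,4)])
      show "0 \<le> \<Lambda> i" if "i \<in> I" for i using nonneg that by blast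
      show "cut_constraint I R C \<Lambda> S" if "S \<subseteq> J" for S
      proof (rule cut_constraint_if_strongly_connected[OF assms(1,2) _ _ _ that])
        show "R i \<noteq> {}" if "i \<in> I" for i using assms(4)[OF that] by blast
        show "0 \<le> \<Lambda> i" if "i \<in> I" for i using nonneg that by blast
        show "cut_constraint I R C \<Lambda> S'" if "S' \<in> strongly_connected_sets I J R" for S'
          using sc that by blast
      qed
    qed
  qed
next
  fix T assume T: "T \<in> strongly_connected_sets I J R" "confined_users I R T \<noteq> {}"
  have routes: "\<And>i. i \<in> I \<Longrightarrow> R i \<noteq> {}" using assms(4) by blast
  obtain \<Lambda> :: "'i \<Rightarrow> real" where \<Lambda>: "(\<forall>i\<in>I. 0 \<le> \<Lambda> i) \<and>
    (\<forall>S\<subseteq>J. S \<noteq> T \<longrightarrow> cut_constraint I R C \<Lambda> S) \<and> \<not> cut_constraint I R C \<Lambda> T"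
    using cut_constraint_irredundant[where C = C, OF assms(1-3) routes T] ..
  have "T \<subseteq> J" using T(1) by (simp add: strongly_connected_sets_def)
  then have "\<not> feasible I J R C \<Lambda>"
    using cut_constraint_if_feasible[OF assms(1,2)] \<Lambda> by metis
  then show "\<exists>\<Lambda> :: 'i \<Rightarrow> real. (\<forall>i\<in>I. 0 \<le> \<Lambda> i) \<and>
      (\<forall>J'\<in>strongly_connected_sets I J R - {T}. cut_constraint I R C \<Lambda> J') \<and>
      \<not> feasible I J R C \<Lambda>"
    using \<Lambda> by (intro exI[of _ \<Lambda>]) (simp add: strongly_connected_sets_def)
qed

end
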